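(* Let $a=\frac pq\in(0,\frac12)$ be rational ($p,q$ positive integers), $b\in(0,\frac12)$, and let $\theta$ be a non-exceptional direction for the billiard in the square table with one-sided mirror $I=\{a\}\times[0,b]$. Let $p_\theta(n)$ be the complexity of the three-letter coding of the map $S$ defined in the context. Then $$p_\theta(n)\le(2+2q)\,n\quad\text{for all } n\ge1.$$
   Context: Billiard: the table is the square $[0,\frac12]\times[0,\frac12]$ with a vertical wall $I=\{a\}\times[0,b]$. A point particle moves at unit speed along straight lines; at the boundary of the square it is reflected by the usual law. If it arrives at $I$ from the left it passes through unperturbed; if it arrives at $I$ from the right it is reflected by the usual law. A direction $\theta$ is exceptional if there is a billiard orbit in direction $\theta$ from an end point of $I$ to an end point of $I$ (vertical directions are exceptional); otherwise it is non-exceptional. The billiard unfolds to a linear flow on the unit torus $\mathbb R^2/\mathbb Z^2$ with slits $\{a\}\times[-b,b]$ and $\{1-a\}\times[-b,b]$, where a trajectory reaching the reflecting copy jumps from the slit at $x=1-a$ to the slit at $x=a$. The return map $S$ to the union of vertical sections $x=\frac kq$, $k\in\{0,1,\dots,q-1\}$ (the section $x=\frac kq$ being $\{k\}\times\mathbb R/\mathbb Z$) is $$S(i,y)=\begin{cases}(p,\ y+\tan\theta/q \bmod 1)&\text{if } i=q-p \text{ and } y\in[-b,b],\\ (i+1 \bmod q,\ y+\tan\theta/q \bmod 1)&\text{otherwise.}\end{cases}$$ Orbits of $S$ are coded by a three-letter alphabet: two letters for the section on which $S$ is discontinuous (one for $\{q-p\}\times[-b,b]$, the other for the rest of the section $i=q-p$)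 and a third letter for all the other sections. $p_\theta(n)$ is the number of distinct words of length $n$ appearing in the codes of all points. *)

theory Defs
  imports "HOL-Analysis.Product_Vector"
begin

section \<open>The billiard with a one-sided mirror\<close>

definition table :: "(real \<times> real) set" where
  "table = {0..1/2} \<times> {0..1/2}"

definition mirror :: "real \<Rightarrow> real \<Rightarrow> (real \<times> real) set" where
  "mirror a b = {a} \<times> {0..b}"

text \<open>
  The velocity of a particle just after it has arrived at \<open>P\<close> with the velocity \<open>v\<close>. Arriving at the
  mirror from the right means having a negative horizontal velocity there. At a corner of the
  square both components are reversed, which is the continuous extension of the billiard and
  corresponds to a straight line in the unfolding.
\<close>
definition outgoing :: "real \<Rightarrow> real \<Rightarrow> real \<times> real \<Rightarrow> real \<times> real \<Rightarrow> real \<times> real" where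
  "outgoing a b P v =
    ((if fst P = 0 \<and> fst v < 0 \<or> fst P = 1/2 \<and> fst v > 0 \<or> P \<in> mirror a b \<and> fst v < 0
      then - fst v else fst v),
     (if snd P = 0 \<and> snd v < 0 \<or> snd P = 1/2 \<and> snd v > 0
      then - snd v else snd v))"

definition free_flight :: "real \<Rightarrow> real \<Rightarrow> real \<times> real \<Rightarrow> real \<times> real \<Rightarrow> real \<Rightarrow> bool" where
  "free_flight a b P v t \<longleftrightarrow> 0 < t \<and>
     (\<forall>s\<in>{0<..<t}. P + s *\<^sub>R v \<in> table \<and> outgoing a b (P + s *\<^sub>R v) v = v)"

text \<open>
  \<open>billiard_orbit a b P v Q w\<close>: an orbit segment of positive length leaves \<open>P\<close> with velocity \<open>v\<close> and
  arrives at \<open>Q\<close> with velocity \<open>w\<close>. The billiard law is imposed strictly between the two ends only.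
\<close>
inductive billiard_orbit ::
  "real \<Rightarrow> real \<Rightarrow> real \<times> real \<Rightarrow> real \<times> real \<Rightarrow> real \<times> real \<Rightarrow> real \<times> real \<Rightarrow> bool"
  for a b :: real where
  flight: "free_flight a b P v t \<Longrightarrow> billiard_orbit a b P v (P + t *\<^sub>R v) v"
| bounce: "billiard_orbit a b P v Q w \<Longrightarrow> w' = outgoing a b Q w \<Longrightarrow> free_flight a b Q w' t
    \<Longrightarrow> billiard_orbit a b P v (Q + t *\<^sub>R w') w'"

text \<open>
  Reflections in the sides of the square and in the mirror change the signs of the velocity
  components, so a billiard direction is an angle up to these sign changes.
\<close>
definition velocities :: "real \<Rightarrow> (real \<times> real) set" where
  "velocities \<theta> = {cos \<theta>, - cos \<theta>} \<times> {sin \<theta>, - sin \<theta>}"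

definition mirror_ends :: "real \<Rightarrow> real \<Rightarrow> (real \<times> real) set" where
  "mirror_ends a b = {(a, 0), (a, b)}"

definition vertical :: "real \<Rightarrow> bool" where
  "vertical \<theta> \<longleftrightarrow> cos \<theta> = 0"

definition exceptional :: "real \<Rightarrow> real \<Rightarrow> real \<Rightarrow> bool" where
  "exceptional a b \<theta> \<longleftrightarrow> vertical \<theta> \<or>
     (\<exists>P\<in>mirror_ends a b. \<exists>Q\<in>mirror_ends a b. \<exists>v\<in>velocities \<theta>. \<exists>w. billiard_orbit a b P v Q w)"

section \<open>The return map and its coding\<close>

text \<open>\<open>\<real>/\<int>\<close> is represented by \<open>{0..<1}\<close>.\<close>

definition sections :: "nat \<Rightarrow> (nat \<times> real) set" where
  "sections q = {0..<q} \<times> {0..<1}"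

definition slit :: "real \<Rightarrow> real set" where
  "slit b = {y. \<exists>m::int. y + of_int m \<in> {-b..b}}"

definition return_map :: "nat \<Rightarrow> nat \<Rightarrow> real \<Rightarrow> real \<Rightarrow> nat \<times> real \<Rightarrow> nat \<times> real" where
  "return_map p q b \<theta> = (\<lambda>(i, y).
     if i = q - p \<and> y \<in> slit b then (p, frac (y + tan \<theta> / real q))
     else ((i + 1) mod q, frac (y + tan \<theta> / real q)))"

datatype letter = Slit | Off_Slit | Other

definition letter_of :: "nat \<Rightarrow> nat \<Rightarrow> real \<Rightarrow> nat \<times> real \<Rightarrow> letter" where
  "letter_of p q b = (\<lambda>(i, y).
     if i = q - p then (if y \<in> slit b then Slit else Off_Slit) else Other)"

definition code :: "nat \<Rightarrow> nat \<Rightarrow> real \<Rightarrow> real \<Rightarrow> nat \<times> real \<Rightarrow> nat \<Rightarrow> letter" where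
  "code p q b \<theta> x k = letter_of p q b ((return_map p q b \<theta> ^^ k) x)"

definition factors :: "nat \<Rightarrow> nat \<Rightarrow> real \<Rightarrow> real \<Rightarrow> nat \<Rightarrow> letter list set" where
  "factors p q b \<theta> n = {map (code p q b \<theta> x) [m..<m + n] | x m. x \<in> sections q}"

definition complexity :: "nat \<Rightarrow> nat \<Rightarrow> real \<Rightarrow> real \<Rightarrow> nat \<Rightarrow> nat" where
  "complexity p q b \<theta> n = card (factors p q b \<theta> n)"

end

theory Submission
  imports Defs
begin

text \<open>
  The second coordinate of \<open>S\<close> always evolves by the rotation by \<open>\<alpha> = tan \<theta> / q\<close>, so the word of
  length \<open>n\<close> read from \<open>(i, y)\<close> depends only on \<open>i\<close> and on which of the points \<open>y + k\<alpha>\<close>, \<open>k < n\<close>, lie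
  in the arc \<open>[-b, b]\<close>. If points \<open>y\<close> with pairwise different words are listed in cyclic order,
  between two neighbours some \<open>y + k\<alpha>\<close> must enter or leave the arc. In one turn of the circle each
  of these \<open>2n\<close> events happens once, so every section carries at most \<open>2n\<close> words and there are at
  most \<open>2qn\<close> words altogether.
\<close>

section \<open>Periodicity and crossings of the arc on the real line\<close>

lemma slit_add_of_int [simp]: "y + of_int m \<in> slit b \<longleftrightarrow> y \<in> slit b"
proof
  assume "y + of_int m \<in> slit b"
  then obtain l :: int where "y + of_int m + of_int l \<in> {-b..b}"
    by (auto simp: slit_def)
  then have "y + of_int (m + l) \<in> {-b..b}"
    by (simp add: add.assoc)
  then show "y \<in> slit b"
    unfolding slit_def by blast
next
  assume "y \<in> slit b"
  then obtain l :: int where "y + of_int l \<in> {-b..b}"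
    by (auto simp: slit_def)
  then have "y + of_int m + of_int (l - m) \<in> {-b..b}"
    by simp
  then show "y + of_int m \<in> slit b"
    unfolding slit_def by blast
qed

lemma slit_frac [simp]: "frac y \<in> slit b \<longleftrightarrow> y \<in> slit b"
  using slit_add_of_int[of y "- \<lfloor>y\<rfloor>" b] by (simp add: frac_def)

text \<open>An integer translation bringing \<open>v\<close> into \<open>{-b..b}\<close> leaves
  \<open>u\<close> to the left of it, so a left end separates them. As the arc is closed, this end
  lies in \<open>(u, v]\<close>, whereas \<open>slit_leave\<close> finds a right end in
  \<open>[u, v)\<close>. Being half-open, adjacent intervals cannot share such an end.\<close>

lemma slit_enter:
  assumes "u < v" "u \<notin> slit b" "v \<in> slit b"
  obtains m :: int where "u < of_int m - b" "of_int m - b \<le> v"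
proof -
  obtain m :: int where m: "v + of_int m \<in> {-b..b}"
    using assms(3) by (auto simp: slit_def)
  have "u + of_int m \<notin> {-b..b}"
    using assms(2) by (auto simp: slit_def)
  then show thesis
    using m assms(1) by (intro that[of "- m"]) auto
qed

lemma slit_leave:
  assumes "u < v" "u \<in> slit b" "v \<notin> slit b"
  obtains m :: int where "u \<le> of_int m + b" "of_int m + b < v"
proof -
  obtain m :: int where m: "u + of_int m \<in> {-b..b}"
    using assms(2) by (auto simp: slit_def)
  have "v + of_int m \<notin> {-b..b}"
    using assms(3) by (auto simp: slit_def)
  then show thesis
    using m assms(1) by (intro that[of "- m"]) auto
qed

section \<open>Cyclic order and the count of separated points\<close>

text \<open>The successor of a point of \<open>R \<subseteq> [0, 1)\<close> in the cyclic order, lifted to the real line.\<close>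

definition cyclic_succ :: "real set \<Rightarrow> real \<Rightarrow> real" where
  "cyclic_succ R y = (if \<exists>z\<in>R. y < z then Min {z\<in>R. y < z} else Min R + 1)"

lemma cyclic_succ_cases:
  assumes "finite R" "R \<subseteq> {0..<1}" "y \<in> R"
  obtains "y < cyclic_succ R y" "cyclic_succ R y \<in> R"
    | "y < cyclic_succ R y" "cyclic_succ R y - 1 \<in> R" "cyclic_succ R y - 1 = Min R" "y = Max R"
proof (cases "\<exists>z\<in>R. y < z")
  case True
  then have "Min {z\<in>R. y < z} \<in> {z\<in>R. y < z}"
    using assms(1) by (intro Min_in) auto
  then show thesis
    using that(1) True by (auto simp: cyclic_succ_def)
next
  case False
  have "Min R \<in> R"
    using assms by (intro Min_in) auto
  moreover have "Max R = y"
    using False assms by (intro Max_eqI) auto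
  moreover have "cyclic_succ R y = Min R + 1"
    using False by (simp add: cyclic_succ_def)
  moreover have "0 \<le> Min R" "y < 1"
    using \<open>Min R \<in> R\<close> assms by auto
  ultimately show thesis
    by (intro that(2)) simp_all
qed

lemma cyclic_succ_le:
  assumes "finite R" "z \<in> R" "y < z"
  shows "cyclic_succ R y \<le> z"
  using assms by (auto simp: cyclic_succ_def)

text \<open>Together with \<open>cyclic_succ_le\<close>, this places the gaps after two points
  \<open>y < z\<close> one behind the other within the single turn from \<open>y\<close> to
  \<open>y + 1\<close>.\<close>

lemma cyclic_succ_le_add_1:
  assumes "finite R" "R \<subseteq> {0..<1}" "y \<in> R" "z \<in> R"
  shows "cyclic_succ R z \<le> y + 1"
proof (cases rule: cyclic_succ_cases[OF assms(1,2,4)])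
  case 1
  then have "cyclic_succ R z < 1" "0 \<le> y"
    using assms by auto
  then show ?thesis by simp
next
  case 2
  then show ?thesis
    using Min_le[OF assms(1,3)] by simp
qed

lemma card_separated_by_rotated_slit:
  fixes R :: "real set" and c :: "nat \<Rightarrow> real"
  assumes fin: "finite R" and R: "R \<subseteq> {0..<1}" and "1 \<le> n"
    and sep: "\<And>y z. y \<in> R \<Longrightarrow> z \<in> R \<Longrightarrow> y \<noteq> z \<Longrightarrow> \<exists>k<n. (y + c k \<in> slit b) \<noteq> (z + c k \<in> slit b)"
  shows "card R \<le> 2 * n"
\<comment> \<open>With at most one point there are no two distinct neighbours to compare; the bound
  then comes from \<open>1 \<le> n\<close>.\<close>
proof (cases "card R \<le> 1")
  case True
  then show ?thesis using \<open>1 \<le> n\<close> by simp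
next
  case False
  let ?s = "cyclic_succ R"
  have change: "\<exists>k<n. (y + c k \<in> slit b) \<noteq> (?s y + c k \<in> slit b)" if y: "y \<in> R" for y
  proof (cases rule: cyclic_succ_cases[OF fin R y])
    case 1
    then show ?thesis using sep[OF y, of "?s y"] by auto
  next
    case 2
    \<comment> \<open>The wrap-around gap runs from \<open>Max R\<close> to
      \<open>Min R + 1\<close>; \<open>sep\<close> applies to its ends modulo 1 only if they
      differ.\<close>
    have "Min R \<noteq> Max R"
    proof
      assume "Min R = Max R"
      then have "z = Max R" if "z \<in> R" for z
        using Min_le[OF fin that] Max_ge[OF fin that] by simp
      then have "R \<subseteq> {Max R}" by auto
      then show False
        using False card_mono[of "{Max R}" R] by simp
    qed
    then obtain k where "k < n" "(y + c k \<in> slit b) \<noteq> (?s y - 1 + c k \<in> slit b)"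
      using sep[OF y, of "?s y - 1"] 2 by auto
    moreover have "?s y - 1 + c k \<in> slit b \<longleftrightarrow> ?s y + c k \<in> slit b"
      using slit_add_of_int[of "?s y + c k" "- 1" b] by (simp add: algebra_simps)
    ultimately show ?thesis by blast
  qed
  then obtain K where K: "K y < n" "(y + c (K y) \<in> slit b) \<noteq> (?s y + c (K y) \<in> slit b)"
    if "y \<in> R" for y
    by metis
  \<comment> \<open>The flag is true if the arc is left, and false if it is entered, between
    \<open>y\<close> and its successor after the shift by \<open>c (K y)\<close>.\<close>
  define event where "event y = (K y, y + c (K y) \<in> slit b)" for y
  have lt_succ: "y < ?s y" if "y \<in> R" for y
    by (rule cyclic_succ_cases[OF fin R that])
  \<comment> \<open>Equal events would give ends of the same kind, of the translates of the arc by
    \<open>l\<close> and \<open>m\<close>, in two successive gaps. The order of the gaps forces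
    \<open>l < m\<close>, and their lying within one turn forces \<open>m < l + 1\<close>.\<close>
  have distinct: "event y \<noteq> event z" if y: "y \<in> R" and z: "z \<in> R" and "y < z" for y z
  proof
    assume eq: "event y = event z"
    define k where "k = K y"
    have kz: "K z = k" and same: "(y + c k \<in> slit b) = (z + c k \<in> slit b)"
      using eq by (auto simp: event_def k_def)
    have succ: "?s y \<le> z" "?s z \<le> y + 1"
      using cyclic_succ_le[OF fin z \<open>y < z\<close>] cyclic_succ_le_add_1[OF fin R y z] by auto
    have lt: "y + c k < ?s y + c k" "z + c k < ?s z + c k"
      using lt_succ y z by auto
    show False
    proof (cases "y + c k \<in> slit b")
      case True
      then have "?s y + c k \<notin> slit b" "z + c k \<in> slit b" "?s z + c k \<notin> slit b"
        using K(2)[OF y] K(2)[OF z] same kz by (auto simp: k_def)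
      then obtain l m :: int
        where "y + c k \<le> of_int l + b" "of_int l + b < ?s y + c k"
          and "z + c k \<le> of_int m + b" "of_int m + b < ?s z + c k"
        using slit_leave[OF lt(1) True] slit_leave[OF lt(2)] by metis
      then have "real_of_int l < of_int m" "real_of_int m < of_int (l + 1)"
        using succ by simp_all
      then show False
        unfolding of_int_less_iff by simp
    next
      case False
      then have "?s y + c k \<in> slit b" "z + c k \<notin> slit b" "?s z + c k \<in> slit b"
        using K(2)[OF y] K(2)[OF z] same kz by (auto simp: k_def)
      then obtain l m :: int
        where "y + c k < of_int l - b" "of_int l - b \<le> ?s y + c k"
          and "z + c k < of_int m - b" "of_int m - b \<le> ?s z + c k"
        using slit_enter[OF lt(1) False] slit_enter[OF lt(2)] by metis
      then have "real_of_int l < of_int m" "real_of_int m < of_int (l + 1)"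
        using succ by simp_all
      then show False
        unfolding of_int_less_iff by simp
    qed
  qed
  have "inj_on event R"
    using distinct by (intro inj_onI) (metis linorder_neqE)
  moreover have "event ` R \<subseteq> {..<n} \<times> UNIV"
    using K(1) by (auto simp: event_def)
  ultimately have "card R \<le> card ({..<n} \<times> (UNIV :: bool set))"
    by (intro card_inj_on_le) auto
  then show ?thesis
    by (simp add: card_cartesian_product)
qed

section \<open>The return map as a rotation with section indices\<close>

lemma fst_return_map:
  "fst (return_map p q b \<theta> x) = (if fst x = q - p \<and> snd x \<in> slit b then p else (fst x + 1) mod q)"
  by (simp add: return_map_def split_beta)

lemma snd_return_map: "snd (return_map p q b \<theta> x) = frac (snd x + tan \<theta> / real q)"
  by (simp add: return_map_def split_beta)

lemma snd_return_map_funpow: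
  assumes "0 \<le> y" "y < 1"
  shows "snd ((return_map p q b \<theta> ^^ k) (i, y)) = frac (y + real k * (tan \<theta> / real q))"
proof (induction k)
  case 0
  then show ?case using assms by (simp add: frac_eq)
next
  case (Suc k)
  let ?\<alpha> = "tan \<theta> / real q"
  have "snd ((return_map p q b \<theta> ^^ Suc k) (i, y)) = frac (frac (y + real k * ?\<alpha>) + ?\<alpha>)"
    by (simp only: funpow.simps comp_apply snd_return_map Suc)
  also have "\<dots> = frac (y + real k * ?\<alpha> + ?\<alpha>)"
    by simp
  finally show ?case by (simp add: algebra_simps add_divide_distrib)
qed

text \<open>The next section is a function of the current section and of slit membership, so by
  induction equal visits keep the section indices equal.\<close>

lemma code_eq_if_same_slit_visits:
  assumes yz: "y \<in> {0..<1}" "z \<in> {0..<1}"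
    and visits: "\<And>k. k < n \<Longrightarrow> (y + real k * (tan \<theta> / real q) \<in> slit b)
      \<longleftrightarrow> (z + real k * (tan \<theta> / real q) \<in> slit b)"
    and "k < n"
  shows "code p q b \<theta> (i, y) k = code p q b \<theta> (i, z) k"
proof -
  let ?S = "return_map p q b \<theta>"
  have same_slit: "snd ((?S ^^ j) (i, y)) \<in> slit b \<longleftrightarrow> snd ((?S ^^ j) (i, z)) \<in> slit b"
    if "j < n" for j
    using visits[OF that] yz by (simp add: snd_return_map_funpow)
  have "fst ((?S ^^ j) (i, y)) = fst ((?S ^^ j) (i, z))" if "j < n" for j
    using that
  proof (induction j)
    case (Suc j)
    then show ?case
      using same_slit[of j] by (simp add: fst_return_map)
  qed simp
  then show ?thesis
    using same_slit \<open>k < n\<close> by (simp add: code_def letter_of_def split_beta)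
qed

section \<open>Words of length \<open>n\<close> and their number\<close>

lemma return_map_in_sections:
  assumes "p < q" "x \<in> sections q"
  shows "return_map p q b \<theta> x \<in> sections q"
  using assms by (auto simp: sections_def return_map_def frac_lt_1)

lemma return_map_funpow_in_sections:
  assumes "p < q" "x \<in> sections q"
  shows "(return_map p q b \<theta> ^^ k) x \<in> sections q"
  using assms by (induction k) (auto intro: return_map_in_sections)

text \<open>A factor starting at time \<open>m\<close> is the initial word of the
  \<open>m\<close>-th iterate, which stays in \<open>sections q\<close>.\<close>

lemma factors_eq_initial_words:
  assumes "p < q"
  shows "factors p q b \<theta> n = (\<Union>i<q. (\<lambda>y. map (code p q b \<theta> (i, y)) [0..<n]) ` {0..<1})"
proof (intro equalityI subsetI)
  fix w assume "w \<in> factors p q b \<theta> n"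
  then obtain x m where x: "x \<in> sections q" and w: "w = map (code p q b \<theta> x) [m..<m + n]"
    by (auto simp: factors_def)
  obtain i y where iy: "(return_map p q b \<theta> ^^ m) x = (i, y)"
    by fastforce
  have "i < q" "y \<in> {0..<1}"
    using return_map_funpow_in_sections[OF assms x, of m b \<theta>] by (auto simp: iy sections_def)
  moreover have "w = map (code p q b \<theta> (i, y)) [0..<n]"
  proof (rule nth_equalityI)
    fix j assume "j < length w"
    then show "w ! j = map (code p q b \<theta> (i, y)) [0..<n] ! j"
      unfolding w by (simp add: code_def iy[symmetric] funpow_add add.commute[of m])
  qed (simp add: w)
  ultimately show "w \<in> (\<Union>i<q. (\<lambda>y. map (code p q b \<theta> (i, y)) [0..<n]) ` {0..<1})"
    by blast
next
  fix w assume "w \<in> (\<Union>i<q. (\<lambda>y. map (code p q b \<theta> (i, y)) [0..<n]) ` {0..<1})"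
  then obtain i y where "(i, y) \<in> sections q" "w = map (code p q b \<theta> (i, y)) [0..<0 + n]"
    by (auto simp: sections_def)
  then show "w \<in> factors p q b \<theta> n"
    unfolding factors_def by blast
qed

lemma card_words_from_section:
  assumes "1 \<le> n"
  shows "card ((\<lambda>y. map (code p q b \<theta> (i, y)) [0..<n]) ` {0..<1}) \<le> 2 * n"
proof -
  let ?g = "\<lambda>y. map (code p q b \<theta> (i, y)) [0..<n]"
  \<comment> \<open>The count of separated points concerns finite sets, so every finite set of words
    is bounded first.\<close>
  have "card W \<le> 2 * n" if W: "W \<subseteq> ?g ` {0..<1}" "finite W" for W
  proof -
    \<comment> \<open>\<open>R\<close> holds one starting height for each word of
      \<open>W\<close>.\<close>
    obtain R where R: "R \<subseteq> {0..<1}" "inj_on ?g R" "W = ?g ` R"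
      using W(1) by (auto simp: subset_image_inj)
    have "finite R"
      using R W(2) finite_imageD by blast
    then have "card R \<le> 2 * n"
      using R(1) assms
    proof (rule card_separated_by_rotated_slit[where b = b and c = "\<lambda>k. real k * (tan \<theta> / real q)"])
      fix y z assume "y \<in> R" "z \<in> R" "y \<noteq> z"
      moreover from this have "?g y \<noteq> ?g z"
        using R(2) by (auto dest: inj_onD)
      ultimately show "\<exists>k<n. (y + real k * (tan \<theta> / real q) \<in> slit b)
          \<noteq> (z + real k * (tan \<theta> / real q) \<in> slit b)"
        using R(1) code_eq_if_same_slit_visits[of y z n \<theta> q b _ p i] by fastforce
    qed
    then show ?thesis
      using R by (simp add: card_image)
  qed
  then show ?thesis
    using finite_if_finite_subsets_card_bdd by blast
qed

theorem theorem9: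
  fixes p q :: nat and a b \<theta> :: real
  assumes "0 < p" and "0 < q"
    and "a = real p / real q" and "a \<in> {0<..<1/2}"
    and "b \<in> {0<..<1/2}"
    and "\<not> exceptional a b \<theta>"
  shows "\<forall>n\<ge>1. complexity p q b \<theta> n \<le> (2 + 2 * q) * n"
proof (intro allI impI)
  fix n :: nat assume n: "1 \<le> n"
  have "a < 1"
    using assms(4) by simp
  then have "p < q"
    using assms(2,3) by (simp add: field_simps)
  then have "complexity p q b \<theta> n
      \<le> (\<Sum>i<q. card ((\<lambda>y. map (code p q b \<theta> (i, y)) [0..<n]) ` {0..<1}))"
    unfolding complexity_def factors_eq_initial_words[OF \<open>p < q\<close>] by (intro card_UN_le) simp
  also have "\<dots> \<le> (\<Sum>i<q. 2 * n)"
    by (intro sum_mono card_words_from_section n)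
  \<comment> \<open>The sum is \<open>2 * q * n\<close>.\<close>
  also have "\<dots> \<le> (2 + 2 * q) * n"
    by simp
  finally show "complexity p q b \<theta> n \<le> (2 + 2 * q) * n" .
qed

end
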